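(* Let $\mathcal{S}=\langle\mathcal{L},\vdash\rangle$ be a logic with $\mathcal{L}$ a formula algebra over a denumerable set of variables $V$. If $\mathrm{var}(\varphi)\neq\emptyset$ for all $\varphi\in\mathcal{L}$, then $\mathcal{S}^{pl}$ is NF-paraconsistent. Moreover, if in addition $\emptyset\not\vdash q$ for all $q\in V$, then $\mathcal{S}^{l}$ is also NF-paraconsistent.
   Context: A logic is a pair $\langle\mathcal{L},\vdash\rangle$ with $\vdash\,\subseteq\mathcal{P}(\mathcal{L})\times\mathcal{L}$, and $C_\vdash(\Gamma)=\{\alpha:\Gamma\vdash\alpha\}$. $\mathcal{L}$ is the set of formulas built inductively over a denumerable set $V$ of variables using a finite set of connectives. $\mathrm{var}(\alpha)$ is the set of variables occurring in $\alpha$, and $\mathrm{var}(\Delta)=\bigcup_{\alpha\in\Delta}\mathrm{var}(\alpha)$. $\mathcal{S}^l=\langle\mathcal{L},\vdash^l\rangle$ where $\Gamma\vdash^l\alpha$ iff there is $\Delta\subseteq\Gamma$ with $\mathrm{var}(\Delta)\subseteq\mathrm{var}(\alpha)$ and $\Delta\vdash\alpha$; $\mathcal{S}^{pl}=\langle\mathcal{L},\vdash^{pl}\rangle$ where $\Gamma\vdash^{pl}\alpha$ iff there is a nonempty $\Delta\subseteq\Gamma$ with $\mathrm{var}(\Delta)\subseteq\mathrm{var}(\alpha)$ and $\Delta\vdash\alpha$. A logic $\langle\mathcal{L},\vdash\rangle$ is NF-paraconsistent if there exists $\alpha\in\mathcal{L}$ such that $C_\vdash(\{\alpha,\beta\})\neq\mathcal{L}$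 for every $\beta\in\mathcal{L}$. *)

theory Defs
  imports Main "HOL-Library.Countable_Set"
begin

datatype (vars: 'v, 'c) fm = Var 'v | Conn 'c "('v, 'c) fm list"

text \<open>The carrier of the formula algebra over the variables \<open>V\<close> with connectives \<open>C\<close>,
  where \<open>ar\<close> gives the arities; connectives of arity 0 are allowed.\<close>

inductive_set formulas :: "'v set \<Rightarrow> 'c set \<Rightarrow> ('c \<Rightarrow> nat) \<Rightarrow> ('v, 'c) fm set"
  for V :: "'v set" and C :: "'c set" and ar :: "'c \<Rightarrow> nat" where
  Var: "q \<in> V \<Longrightarrow> Var q \<in> formulas V C ar"
| Conn: "c \<in> C \<Longrightarrow> length ts = ar c \<Longrightarrow> \<forall>t\<in>set ts. t \<in> formulas V C ar
    \<Longrightarrow> Conn c ts \<in> formulas V C ar"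

definition vars_set :: "('v, 'c) fm set \<Rightarrow> 'v set" where
  "vars_set \<Delta> = (\<Union>\<alpha>\<in>\<Delta>. vars \<alpha>)"

type_synonym 'a logic = "'a set \<times> ('a set \<times> 'a) set"

definition is_logic :: "'a logic \<Rightarrow> bool" where
  "is_logic S \<longleftrightarrow> snd S \<subseteq> Pow (fst S) \<times> fst S"

definition consequences :: "'a logic \<Rightarrow> 'a set \<Rightarrow> 'a set" where
  "consequences S \<Gamma> = {\<alpha>. (\<Gamma>, \<alpha>) \<in> snd S}"

definition left_logic :: "('v, 'c) fm logic \<Rightarrow> ('v, 'c) fm logic" where
  "left_logic S = (fst S, {(\<Gamma>, \<alpha>). \<Gamma> \<subseteq> fst S \<and> \<alpha> \<in> fst S \<and>
     (\<exists>\<Delta>\<subseteq>\<Gamma>. vars_set \<Delta> \<subseteq> vars \<alpha> \<and> (\<Delta>, \<alpha>) \<in> snd S)})"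

definition pure_left_logic :: "('v, 'c) fm logic \<Rightarrow> ('v, 'c) fm logic" where
  "pure_left_logic S = (fst S, {(\<Gamma>, \<alpha>). \<Gamma> \<subseteq> fst S \<and> \<alpha> \<in> fst S \<and>
     (\<exists>\<Delta>\<subseteq>\<Gamma>. \<Delta> \<noteq> {} \<and> vars_set \<Delta> \<subseteq> vars \<alpha> \<and> (\<Delta>, \<alpha>) \<in> snd S)})"

definition NF_paraconsistent :: "'a logic \<Rightarrow> bool" where
  "NF_paraconsistent S \<longleftrightarrow>
     (\<exists>\<alpha>\<in>fst S. \<forall>\<beta>\<in>fst S. consequences S {\<alpha>, \<beta>} \<noteq> fst S)"

end

theory Submission
  imports Defs
begin

text \<open>Given \<open>\<alpha>\<close> and \<open>\<beta>\<close>, choose a variable \<open>q\<close> occurring in neither. Any premise drawn from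
  \<open>{\<alpha>, \<beta>}\<close> contains some variable, and that variable is not \<open>q\<close>; so the variable inclusion
  condition leaves only the empty set of premises available for deriving \<open>q\<close>.\<close>

lemma finite_vars: "finite (vars \<phi>)"
  by (induction \<phi>) auto

lemma exists_fresh_variable:
  assumes "infinite V"
  obtains q where "q \<in> V" "q \<notin> vars \<alpha>" "q \<notin> vars \<beta>"
proof -
  have "infinite (V - (vars \<alpha> \<union> vars \<beta>))"
    using assms by (simp add: finite_vars)
  then obtain q where "q \<in> V - (vars \<alpha> \<union> vars \<beta>)"
    using infinite_imp_nonempty by blast
  then show thesis using that by blast
qed

lemma premises_of_fresh_variable_empty:
  assumes "\<Delta> \<subseteq> {\<alpha>, \<beta>}" "vars_set \<Delta> \<subseteq> vars (Var q)"
    and "vars \<alpha> \<noteq> {}" "vars \<beta> \<noteq> {}" "q \<notin> vars \<alpha>" "q \<notin> vars \<beta>"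
  shows "\<Delta> = {}"
proof (rule ccontr)
  assume "\<Delta> \<noteq> {}"
  then obtain \<delta> where "\<delta> \<in> \<Delta>" by blast
  then have "vars \<delta> \<subseteq> {q}" "\<delta> = \<alpha> \<or> \<delta> = \<beta>"
    using assms(1,2) by (auto simp: vars_set_def)
  \<comment> \<open>Being nonempty, \<open>vars \<delta>\<close> would equal \<open>{q}\<close>, so
    \<open>q\<close> would occur in \<alpha> or \<beta>.\<close>
  then show False using assms(3-6) by blast
qed

text \<open>Collects what the two logics share, so that for each of them only the underivability of
  a fresh variable remains to be checked. Since \<beta> has finitely many variables, some variable
  in \<open>V\<close> is always fresh, and it is a formula outside the consequences.\<close>

lemma NF_paraconsistentI_fresh_variable:
  assumes "infinite V" "fst S = formulas V C ar"
    and "\<And>\<alpha> \<beta> q. \<lbrakk>\<alpha> \<in> fst S; \<beta> \<in> fst S; q \<in> V; q \<notin> vars \<alpha>; q \<notin> vars \<beta>\<rbrakk>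
      \<Longrightarrow> ({\<alpha>, \<beta>}, Var q) \<notin> snd S"
  shows "NF_paraconsistent S"
proof -
  have Var_in: "Var q \<in> fst S" if "q \<in> V" for q
    using that assms(2) by (simp add: formulas.Var)
  \<comment> \<open>The witness for \<alpha> can be any formula; a variable is at hand because
    \<open>V\<close> is nonempty.\<close>
  obtain p where "p \<in> V" using assms(1) infinite_imp_nonempty by blast
  moreover have "consequences S {Var p, \<beta>} \<noteq> fst S" if "\<beta> \<in> fst S" for \<beta>
  proof -
    \<comment> \<open>Only the witness \<open>Var p\<close> is fixed in advance; the missing
      consequence \<open>Var q\<close> may depend on \<beta>.\<close>
    obtain q where "q \<in> V" "q \<notin> vars (Var p :: ('a, 'b) fm)" "q \<notin> vars \<beta>"
      using exists_fresh_variable[OF assms(1)] by blast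
    then have "Var q \<notin> consequences S {Var p, \<beta>}" "Var q \<in> fst S"
      using assms(3) Var_in \<open>p \<in> V\<close> that by (simp_all add: consequences_def)
    then show ?thesis by blast
  qed
  ultimately show ?thesis
    unfolding NF_paraconsistent_def using Var_in by blast
qed

theorem theorem2p17:
  fixes V :: "'v set" and C :: "'c set" and ar :: "'c \<Rightarrow> nat"
    and L :: "('v, 'c) fm set" and D :: "(('v, 'c) fm set \<times> ('v, 'c) fm) set"
  assumes "countable V" and "infinite V" and "finite C"
    and "L = formulas V C ar"
    and "is_logic (L, D)"
    and "\<forall>\<phi>\<in>L. vars \<phi> \<noteq> {}"
  shows "NF_paraconsistent (pure_left_logic (L, D)) \<and>
    ((\<forall>q\<in>V. ({}, Var q) \<notin> D) \<longrightarrow> NF_paraconsistent (left_logic (L, D)))"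
proof (intro conjI impI)
  \<comment> \<open>Both logics impose the same inclusion of variables on \<Delta>, so this fact
    serves both; they differ only in whether \<Delta> may be empty.\<close>
  have empty: "\<Delta> = {}"
    if "\<alpha> \<in> L" "\<beta> \<in> L" "q \<notin> vars \<alpha>" "q \<notin> vars \<beta>"
      "\<Delta> \<subseteq> {\<alpha>, \<beta>}" "vars_set \<Delta> \<subseteq> vars (Var q :: ('v, 'c) fm)" for \<alpha> \<beta> q \<Delta>
    using premises_of_fresh_variable_empty that assms(6) by metis
  show "NF_paraconsistent (pure_left_logic (L, D))"
  proof (rule NF_paraconsistentI_fresh_variable[OF assms(2)])
    show "fst (pure_left_logic (L, D)) = formulas V C ar"
      using assms(4) by (simp add: pure_left_logic_def)
    fix \<alpha> \<beta> q
    assume "\<alpha> \<in> fst (pure_left_logic (L, D))" "\<beta> \<in> fst (pure_left_logic (L, D))"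
      and fresh: "q \<notin> vars \<alpha>" "q \<notin> vars \<beta>"
    then have "\<alpha> \<in> L" "\<beta> \<in> L" by (simp_all add: pure_left_logic_def)
    note empty = empty[OF this fresh]
    show "({\<alpha>, \<beta>}, Var q) \<notin> snd (pure_left_logic (L, D))"
    proof
      assume "({\<alpha>, \<beta>}, Var q) \<in> snd (pure_left_logic (L, D))"
      then obtain \<Delta> where "\<Delta> \<subseteq> {\<alpha>, \<beta>}" "vars_set \<Delta> \<subseteq> vars (Var q :: ('v, 'c) fm)"
        and "\<Delta> \<noteq> {}"
        unfolding pure_left_logic_def by auto
      \<comment> \<open>The pure variant rules out an empty \<Delta> by definition, so nothing about
        theorems of the original logic is used.\<close>
      with empty show False by metis
    qed
  qed
  assume no_axiom: "\<forall>q\<in>V. ({}, Var q) \<notin> D"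
  show "NF_paraconsistent (left_logic (L, D))"
  proof (rule NF_paraconsistentI_fresh_variable[OF assms(2)])
    show "fst (left_logic (L, D)) = formulas V C ar"
      using assms(4) by (simp add: left_logic_def)
    fix \<alpha> \<beta> q
    assume "\<alpha> \<in> fst (left_logic (L, D))" "\<beta> \<in> fst (left_logic (L, D))"
      and "q \<in> V" and fresh: "q \<notin> vars \<alpha>" "q \<notin> vars \<beta>"
    then have "\<alpha> \<in> L" "\<beta> \<in> L" by (simp_all add: left_logic_def)
    note empty = empty[OF this fresh]
    show "({\<alpha>, \<beta>}, Var q) \<notin> snd (left_logic (L, D))"
    proof
      assume "({\<alpha>, \<beta>}, Var q) \<in> snd (left_logic (L, D))"
      then obtain \<Delta> where "\<Delta> \<subseteq> {\<alpha>, \<beta>}" "vars_set \<Delta> \<subseteq> vars (Var q :: ('v, 'c) fm)"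
        and "(\<Delta>, Var q) \<in> D"
        unfolding left_logic_def by auto
      \<comment> \<open>Here an empty \<Delta> is admissible, but it would make the variable
        \<open>q\<close> a theorem of the original logic, contrary to
        \<open>no_axiom\<close>.\<close>
      with empty no_axiom \<open>q \<in> V\<close> show False by metis
    qed
  qed
qed

end
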